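(* Let $X$ be a topological space, let $M>0$ be a real number, and let $f,g\colon X\to(-M,M)$ be two $M$-bounded tame functions on $X$ (not necessarily continuous), with associated $(2M+1)$-bifiltrations $\widehat{F}$ and $\widehat{G}$ respectively. Then for every $k\in\mathbb{N}$ and every real $p\geqslant 0$, $$\mathrm{d}\big(E_pH_k\widehat{F},\,E_pH_k\widehat{G}\big)\leqslant\|f-g\|_\infty,$$ where $\|f-g\|_\infty=\sup_{x\in X}|f(x)-g(x)|$, $\mathrm{d}$ is the interleaving extended pseudometric, and $E_pH_k$ denotes extended $p$-persistent $k$-th homology.
   Context: Conventions: all homology is singular homology with coefficients in $\mathbb{Z}/2\mathbb{Z}$, and $0\in\mathbb{N}$. $\mathbb{R}_\leqslant$ is the poset category of $(\mathbb{R},\leqslant)$: its objects are real numbers, with exactly one morphism $a\to b$, written $a\leqslant b$, if $a\leqslant b$, and none otherwise. $[\mathbb{R}_\leqslant,\mathcal{D}]$ is the category of functors $\mathbb{R}_\leqslant\to\mathcal{D}$ (called diagrams) and natural transformations. $\mathsf{Vec}$ is the category of finite-dimensional $\mathbb{Z}/2\mathbb{Z}$-vector spaces and linear maps; $\mathsf{Vec}_\infty$ is the category of all $\mathbb{Z}/2\mathbb{Z}$-vector spaces and linear maps. Tameness: let $D\in[\mathbb{R}_\leqslant,\mathsf{Vec}]$. A real number $a$ is a regular value of $D$ if there is an open interval $J\ni a$ such that $D(b\leqslant c)$ is an isomorphism for all $b\leqslant c$ in $J$; otherwise $a$ is a critical value. $D$ is tame if it has finitely many critical values. $M$-bounded tame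 functions: for a function $f\colon X\to(-M,M)$ (not assumed continuous), put $F(a)=f^{-1}\big((-\infty,a]\big)\subseteq X$ with the subspace topology, and let $F(a\leqslant b)$ be the inclusion $F(a)\hookrightarrow F(b)$. Then $f$ is an $M$-bounded tame function on $X$ if, for every $k\in\mathbb{N}$, the diagram $H_kF\colon a\mapsto H_k(F(a))$ takes values in finite-dimensional vector spaces and is tame. Bifiltration: the $(2M+1)$-bifiltration associated to $f$ is the family of topological pairs $$\widehat{F}(a)=\big(F_\uparrow(a),F^\downarrow_s(a)\big),\quad F_\uparrow(a)=f^{-1}\big((-\infty,a]\big),\quad F^\downarrow_s(a)=f^{-1}\big([2M+1-a,\infty)\big),\quad a\in\mathbb{R}.$$ Since $f$ takes values in $(-M,M)$, one has $F^\downarrow_s(a)=\varnothing$ for $a<M+1$ and $F_\uparrow(a)=X$ for $a\geqslant M$, so this is a pair for every $a$. For $a\leqslant b$, $\widehat{F}(a\leqslant b)$ is the inclusion of pairs $\widehat{F}(a)\hookrightarrow\widehat{F}(b)$. Thus $\widehat{F}$ is a functor from $\mathbb{R}_\leqslant$ to topological pairs, and $H_k\widehat{F}(a)=H_k\big(F_\uparrow(a),F^\downarrow_s(a)\big)$ (relative homology) defines a diagram in $[\mathbb{R}_\leqslant,\mathsf{Vec}_\infty]$. The bifiltration $\widehat{G}$ is defined in the same way from $g$. Extended persistent homology: for $p\geqslant0$ and $k\in\mathbb{N}$, $E_pH_k\widehat{F}(a)$ is the image of the linear map $H_k\widehat{F}(a\leqslant a+p)\colon H_k\widehat{F}(a)\to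 H_k\widehat{F}(a+p)$. With the maps $E_pH_k\widehat{F}(a)\to E_pH_k\widehat{F}(b)$ (for $a\leqslant b$) given by restriction of $H_k\widehat{F}(a+p\leqslant b+p)$, this is a diagram $E_pH_k\widehat{F}\in[\mathbb{R}_\leqslant,\mathsf{Vec}_\infty]$. Interleaving extended pseudometric: for $\varepsilon\geqslant0$ let $T_\varepsilon\colon\mathbb{R}_\leqslant\to\mathbb{R}_\leqslant$ be the functor $a\mapsto a+\varepsilon$. Two diagrams $D,E\in[\mathbb{R}_\leqslant,\mathcal{D}]$ are $\varepsilon$-interleaved if there exist natural transformations $\varphi\colon D\Rightarrow ET_\varepsilon$ and $\psi\colon E\Rightarrow DT_\varepsilon$ such that, for all $a\in\mathbb{R}$, $\psi(a+\varepsilon)\circ\varphi(a)=D(a\leqslant a+2\varepsilon)$ and $\varphi(a+\varepsilon)\circ\psi(a)=E(a\leqslant a+2\varepsilon)$. Define $\mathrm{d}(D,E)=\inf\{\varepsilon\geqslant0 \mid D\text{ and }E\text{ are }\varepsilon\text{-interleaved}\}\in[0,\infty]$, with $\inf\varnothing=\infty$. *)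

theory Defs
  imports "HOL-Homology.Homology" "HOL-Library.Z2" "HOL-Library.Extended_Nonnegative_Real"
    "Jordan_Normal_Form.VS_Connect"
begin

section \<open>Vector spaces over the field with two elements\<close>

text \<open>
  Vector spaces and linear maps are those of the locales \<^locale>\<open>vectorspace\<close> and
  \<^locale>\<open>linear_map\<close>. Maps between vector spaces are HOL functions of
  which only the values on the carrier are relevant. The fields \<open>mult\<close> and \<open>one\<close> of a module record are not used.
\<close>

type_synonym 'v vec2 = "(bit, 'v) module"

definition F2 :: "bit ring"
  where "F2 = class_ring"

definition vec2_iso :: "'v vec2 \<Rightarrow> 'w vec2 \<Rightarrow> ('v \<Rightarrow> 'w) \<Rightarrow> bool"
  where "vec2_iso V W T \<longleftrightarrow> linear_map F2 V W T \<and> bij_betw T (carrier V) (carrier W)"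

text \<open>
  In the scalar multiplication of the quotient the summand \<open>N\<close> is needed for the scalar \<open>0\<close>,
  since \<open>{0 \<odot> v | v \<in> A}\<close> is not a coset in general.
\<close>

definition quotient_space :: "'v vec2 \<Rightarrow> 'v set \<Rightarrow> 'v set vec2"
  where "quotient_space V N =
    \<lparr>carrier = a_rcosets\<^bsub>V\<^esub> N, mult = undefined, one = undefined,
     zero = N, add = (\<lambda>A B. A <+>\<^bsub>V\<^esub> B),
     smult = (\<lambda>r A. N <+>\<^bsub>V\<^esub> ((\<lambda>v. r \<odot>\<^bsub>V\<^esub> v) ` A))\<rparr>"


section \<open>Singular homology of pairs with coefficients in the field with two elements\<close>

text \<open>
  This follows \<^theory>\<open>HOL-Homology.Simplices\<close> and \<^theory>\<open>HOL-Homology.Homology_Groups\<close>, with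
  coefficients in \<^typ>\<open>bit\<close> instead of \<^typ>\<open>int\<close>. Singular simplices and their faces are those
  of the library. Every nonzero coefficient is \<open>1\<close>, so linear extension is a sum over the
  support of the chain, and there are no signs in the boundary.
\<close>

type_synonym 'a chain2 = "((nat \<Rightarrow> real) \<Rightarrow> 'a) \<Rightarrow>\<^sub>0 bit"

definition scale2 :: "bit \<Rightarrow> ('b \<Rightarrow>\<^sub>0 bit) \<Rightarrow> ('b \<Rightarrow>\<^sub>0 bit)"
  where "scale2 r c = Poly_Mapping.map ((*) r) c"

definition extend2 :: "('b \<Rightarrow> ('c \<Rightarrow>\<^sub>0 bit)) \<Rightarrow> ('b \<Rightarrow>\<^sub>0 bit) \<Rightarrow> ('c \<Rightarrow>\<^sub>0 bit)"
  where "extend2 h c = (\<Sum>\<sigma>\<in>Poly_Mapping.keys c. h \<sigma>)"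

definition singular_chain2 :: "nat \<Rightarrow> 'a topology \<Rightarrow> 'a chain2 \<Rightarrow> bool"
  where "singular_chain2 k X c \<longleftrightarrow> Poly_Mapping.keys c \<subseteq> singular_simplex_set k X"

definition chain_boundary2 :: "nat \<Rightarrow> 'a chain2 \<Rightarrow> 'a chain2"
  where "chain_boundary2 k c =
    (if k = 0 then 0
     else extend2 (\<lambda>\<sigma>. \<Sum>i\<le>k. Poly_Mapping.single (singular_face k i \<sigma>) 1) c)"

definition chain_map2 :: "nat \<Rightarrow> ('a \<Rightarrow> 'b) \<Rightarrow> 'a chain2 \<Rightarrow> 'b chain2"
  where "chain_map2 k h c = extend2 (\<lambda>\<sigma>. Poly_Mapping.single (simplex_map k h \<sigma>) 1) c"

definition relcycle2 :: "nat \<Rightarrow> 'a topology \<Rightarrow> 'a set \<Rightarrow> 'a chain2 \<Rightarrow> bool"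
  where "relcycle2 k X S c \<longleftrightarrow>
    singular_chain2 k X c \<and> singular_chain2 (k - 1) (subtopology X S) (chain_boundary2 k c)"

definition relboundary2 :: "nat \<Rightarrow> 'a topology \<Rightarrow> 'a set \<Rightarrow> 'a chain2 \<Rightarrow> bool"
  where "relboundary2 k X S c \<longleftrightarrow>
    (\<exists>d. singular_chain2 (Suc k) X d \<and>
         singular_chain2 k (subtopology X S) (chain_boundary2 (Suc k) d - c))"

definition relcycle_space :: "nat \<Rightarrow> 'a topology \<Rightarrow> 'a set \<Rightarrow> 'a chain2 vec2"
  where "relcycle_space k X S =
    \<lparr>carrier = Collect (relcycle2 k X S), mult = undefined, one = undefined,
     zero = 0, add = (+), smult = scale2\<rparr>"

text \<open>\<open>homology2 k X S\<close> is the \<open>k\<close>-th relative homology \<open>H\<^sub>k(X,S)\<close>; \<open>H\<^sub>k(X)\<close> is the case \<open>S = {}\<close>.\<close>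

definition homology2 :: "nat \<Rightarrow> 'a topology \<Rightarrow> 'a set \<Rightarrow> 'a chain2 set vec2"
  where "homology2 k X S = quotient_space (relcycle_space k X S) (Collect (relboundary2 k X S))"

text \<open>
  The map into \<open>H\<^sub>k(Y,T)\<close> induced by a map of pairs \<open>h\<close> sends the class of \<open>c\<close> to the class of
  \<open>chain_map2 k h c\<close>, which is the set of all sums of a relative boundary of \<open>(Y,T)\<close> and the
  image of a representative.
\<close>

definition hom_induced2 ::
    "nat \<Rightarrow> 'b topology \<Rightarrow> 'b set \<Rightarrow> ('a \<Rightarrow> 'b) \<Rightarrow> 'a chain2 set \<Rightarrow> 'b chain2 set"
  where "hom_induced2 k Y T h K =
    Collect (relboundary2 k Y T) <+>\<^bsub>relcycle_space k Y T\<^esub> (chain_map2 k h ` K)"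


section \<open>Diagrams indexed by the real line\<close>

record 'v diagram =
  Ob :: "real \<Rightarrow> 'v vec2"
  Mor :: "real \<Rightarrow> real \<Rightarrow> 'v \<Rightarrow> 'v"

definition is_diagram :: "'v diagram \<Rightarrow> bool"
  where "is_diagram D \<longleftrightarrow>
    (\<forall>a. vectorspace F2 (Ob D a)) \<and>
    (\<forall>a b. a \<le> b \<longrightarrow> linear_map F2 (Ob D a) (Ob D b) (Mor D a b)) \<and>
    (\<forall>a. \<forall>x\<in>carrier (Ob D a). Mor D a a x = x) \<and>
    (\<forall>a b c. a \<le> b \<longrightarrow> b \<le> c \<longrightarrow>
       (\<forall>x\<in>carrier (Ob D a). Mor D b c (Mor D a b x) = Mor D a c x))"

definition pointwise_fin_dim :: "'v diagram \<Rightarrow> bool"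
  where "pointwise_fin_dim D \<longleftrightarrow> (\<forall>a. vectorspace.fin_dim F2 (Ob D a))"

definition regular_value :: "'v diagram \<Rightarrow> real \<Rightarrow> bool"
  where "regular_value D a \<longleftrightarrow>
    (\<exists>J. open J \<and> is_interval J \<and> a \<in> J \<and>
         (\<forall>b\<in>J. \<forall>c\<in>J. b \<le> c \<longrightarrow> vec2_iso (Ob D b) (Ob D c) (Mor D b c)))"

definition tame :: "'v diagram \<Rightarrow> bool"
  where "tame D \<longleftrightarrow> finite {a. \<not> regular_value D a}"

definition natural_transformation ::
    "'v diagram \<Rightarrow> 'w diagram \<Rightarrow> (real \<Rightarrow> 'v \<Rightarrow> 'w) \<Rightarrow> bool"
  where "natural_transformation D E \<phi> \<longleftrightarrow>
    (\<forall>a. linear_map F2 (Ob D a) (Ob E a) (\<phi> a)) \<and>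
    (\<forall>a b. a \<le> b \<longrightarrow>
       (\<forall>x\<in>carrier (Ob D a). \<phi> b (Mor D a b x) = Mor E a b (\<phi> a x)))"

definition shift :: "real \<Rightarrow> 'v diagram \<Rightarrow> 'v diagram"
  where "shift \<epsilon> D = \<lparr>Ob = (\<lambda>a. Ob D (a + \<epsilon>)), Mor = (\<lambda>a b. Mor D (a + \<epsilon>) (b + \<epsilon>))\<rparr>"

definition interleaved :: "real \<Rightarrow> 'v diagram \<Rightarrow> 'w diagram \<Rightarrow> bool"
  where "interleaved \<epsilon> D E \<longleftrightarrow>
    (\<exists>\<phi> \<psi>. natural_transformation D (shift \<epsilon> E) \<phi> \<and>
           natural_transformation E (shift \<epsilon> D) \<psi> \<and>
           (\<forall>a. \<forall>x\<in>carrier (Ob D a). \<psi> (a + \<epsilon>) (\<phi> a x) = Mor D a (a + 2 * \<epsilon>) x) \<and>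
           (\<forall>a. \<forall>y\<in>carrier (Ob E a). \<phi> (a + \<epsilon>) (\<psi> a y) = Mor E a (a + 2 * \<epsilon>) y))"

text \<open>The infimum of the empty set in \<^typ>\<open>ennreal\<close> is \<open>\<infinity>\<close>.\<close>

definition interleaving_distance :: "'v diagram \<Rightarrow> 'w diagram \<Rightarrow> ennreal"
  where "interleaving_distance D E = Inf {ennreal \<epsilon> | \<epsilon>. 0 \<le> \<epsilon> \<and> interleaved \<epsilon> D E}"

definition persistent_image :: "real \<Rightarrow> 'v diagram \<Rightarrow> 'v diagram"
  where "persistent_image p D =
    \<lparr>Ob = (\<lambda>a. (Ob D (a + p))\<lparr>carrier := Mor D a (a + p) ` carrier (Ob D a)\<rparr>),
     Mor = (\<lambda>a b. Mor D (a + p) (b + p))\<rparr>"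


section \<open>Filtrations by pairs of spaces and extended persistent homology\<close>

type_synonym 'a pair_filtration = "real \<Rightarrow> 'a topology \<times> 'a set"

definition homology_diagram :: "nat \<Rightarrow> 'a pair_filtration \<Rightarrow> 'a chain2 set diagram"
  where "homology_diagram k P =
    \<lparr>Ob = (\<lambda>a. homology2 k (fst (P a)) (snd (P a))),
     Mor = (\<lambda>a b. hom_induced2 k (fst (P b)) (snd (P b)) id)\<rparr>"

definition sublevel_set :: "'a topology \<Rightarrow> ('a \<Rightarrow> real) \<Rightarrow> real \<Rightarrow> 'a set"
  where "sublevel_set X f a = {x \<in> topspace X. f x \<le> a}"

definition superlevel_set :: "'a topology \<Rightarrow> ('a \<Rightarrow> real) \<Rightarrow> real \<Rightarrow> 'a set"
  where "superlevel_set X f a = {x \<in> topspace X. a \<le> f x}"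

definition sublevel_filtration :: "'a topology \<Rightarrow> ('a \<Rightarrow> real) \<Rightarrow> 'a pair_filtration"
  where "sublevel_filtration X f a = (subtopology X (sublevel_set X f a), {})"

definition bifiltration :: "real \<Rightarrow> 'a topology \<Rightarrow> ('a \<Rightarrow> real) \<Rightarrow> 'a pair_filtration"
  where "bifiltration M X f a =
    (subtopology X (sublevel_set X f a), superlevel_set X f (2 * M + 1 - a))"

definition bounded_tame :: "real \<Rightarrow> 'a topology \<Rightarrow> ('a \<Rightarrow> real) \<Rightarrow> bool"
  where "bounded_tame M X f \<longleftrightarrow>
    f \<in> topspace X \<rightarrow> {-M<..<M} \<and>
    (\<forall>k. pointwise_fin_dim (homology_diagram k (sublevel_filtration X f)) \<and>
         tame (homology_diagram k (sublevel_filtration X f)))"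

definition extended_persistent_homology ::
    "real \<Rightarrow> nat \<Rightarrow> real \<Rightarrow> 'a topology \<Rightarrow> ('a \<Rightarrow> real) \<Rightarrow> 'a chain2 set diagram"
  where "extended_persistent_homology p k M X f =
    persistent_image p (homology_diagram k (bifiltration M X f))"


section \<open>Well-definedness\<close>

text \<open>
  The facts below show that the constructions above are diagrams of vector spaces and linear
  maps, and that the bifiltration consists of pairs of spaces.
\<close>

lemma lookup_scale2 [simp]: "Poly_Mapping.lookup (scale2 r c) x = r * Poly_Mapping.lookup c x"
  by (cases r) (auto simp: scale2_def Poly_Mapping.map.rep_eq when_def)

lemma scale2_0 [simp]: "scale2 0 c = 0" by (rule poly_mapping_eqI) simp
lemma scale2_1 [simp]: "scale2 1 c = c" by (rule poly_mapping_eqI) simp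

lemma add_self_poly2 [simp]: "(c::'b \<Rightarrow>\<^sub>0 bit) + c = 0"
  by (rule poly_mapping_eqI) (simp add: lookup_add)

lemma uminus_poly2 [simp]: "- (c::'b \<Rightarrow>\<^sub>0 bit) = c"
  by (metis add_self_poly2 eq_neg_iff_add_eq_0)

lemma diff_poly2: "(a::'b \<Rightarrow>\<^sub>0 bit) - b = a + b"
  by (metis diff_conv_add_uminus uminus_poly2)

lemma extend2_alt:
  assumes "finite A" "Poly_Mapping.keys c \<subseteq> A"
  shows "extend2 h c = (\<Sum>x\<in>A. scale2 (Poly_Mapping.lookup c x) (h x))"
proof -
  have "(\<Sum>x\<in>A. scale2 (Poly_Mapping.lookup c x) (h x))
      = (\<Sum>x\<in>Poly_Mapping.keys c. scale2 (Poly_Mapping.lookup c x) (h x))"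
    by (rule sum.mono_neutral_right) (use assms in \<open>auto simp: in_keys_iff\<close>)
  also have "\<dots> = extend2 h c"
    unfolding extend2_def by (rule sum.cong) (auto simp: in_keys_iff)
  finally show ?thesis ..
qed

lemma scale2_add_left: "scale2 (r + s) c = scale2 r c + scale2 s c"
  by (cases r; cases s) simp_all

lemma scale2_add: "scale2 r (c + d) = scale2 r c + scale2 r d"
  by (cases r) simp_all

lemma scale2_scale2: "scale2 (r * s) c = scale2 r (scale2 s c)"
  by (cases r; cases s) simp_all

lemma extend2_0 [simp]: "extend2 h 0 = 0"
  by (simp add: extend2_def)

lemma extend2_add: "extend2 h (c + d) = extend2 h c + extend2 h d"
proof -
  let ?A = "Poly_Mapping.keys c \<union> Poly_Mapping.keys d"
  have "extend2 h (c + d) = (\<Sum>x\<in>?A. scale2 (Poly_Mapping.lookup (c + d) x) (h x))"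
    by (rule extend2_alt) (auto simp: keys_add)
  then show ?thesis
    using extend2_alt [of ?A c h] extend2_alt [of ?A d h] 
    by (simp only: lookup_add scale2_add_left sum.distrib) simp
qed

lemma extend2_single [simp]: "extend2 h (Poly_Mapping.single x 1) = h x"
  by (simp add: extend2_def)

lemma extend2_cong:
  "(\<And>x. x \<in> Poly_Mapping.keys c \<Longrightarrow> h x = h' x) \<Longrightarrow> extend2 h c = extend2 h' c"
  unfolding extend2_def by (rule sum.cong) auto

lemma singular_chain2_0 [simp]: "singular_chain2 k X 0"
  by (simp add: singular_chain2_def)

lemma singular_chain2_add:
  "\<lbrakk>singular_chain2 k X c; singular_chain2 k X d\<rbrakk> \<Longrightarrow> singular_chain2 k X (c + d)"
  unfolding singular_chain2_def using keys_add [of c d] by blast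

lemma boundary2_0 [simp]: "chain_boundary2 k 0 = 0"
  by (simp add: chain_boundary2_def)

lemma boundary2_add: "chain_boundary2 k (c + d) = chain_boundary2 k c + chain_boundary2 k d"
  by (simp add: chain_boundary2_def extend2_add)

text \<open>The identities for the boundary are transferred from the integral chains of the library.\<close>

definition reduce2 :: "('b \<Rightarrow>\<^sub>0 int) \<Rightarrow> ('b \<Rightarrow>\<^sub>0 bit)"
  where "reduce2 c = Poly_Mapping.map of_int c"

lemma lookup_reduce2 [simp]: "Poly_Mapping.lookup (reduce2 c) x = of_int (Poly_Mapping.lookup c x)"
  by (auto simp: reduce2_def Poly_Mapping.map.rep_eq when_def)

lemma reduce2_add: "reduce2 (c + d) = reduce2 c + reduce2 d"
  by (rule poly_mapping_eqI) (simp add: lookup_add)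
lemma reduce2_diff: "reduce2 (c - d) = reduce2 c - reduce2 d"
  by (rule poly_mapping_eqI) (simp add: lookup_minus del: minus_bit_def)
lemma reduce2_0 [simp]: "reduce2 0 = 0"
  by (rule poly_mapping_eqI) simp
lemma reduce2_frag_of [simp]: "reduce2 (frag_of x) = Poly_Mapping.single x 1"
  by (rule poly_mapping_eqI) (simp add: lookup_single when_def)
lemma reduce2_cmul_sgn [simp]: "reduce2 (frag_cmul ((-1)^i) c) = reduce2 c"
proof (rule poly_mapping_eqI)
  fix x 
  have "((-1)::bit)^i = 1" by (induct i) auto
  then show "Poly_Mapping.lookup (reduce2 (frag_cmul ((-1)^i) c)) x = Poly_Mapping.lookup (reduce2 c) x"
    by simp
qed
lemma reduce2_sum: "reduce2 (sum h A) = (\<Sum>x\<in>A. reduce2 (h x))"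
  by (induct A rule: infinite_finite_induct) (auto simp: reduce2_add)

lemma reduce2_extend: "reduce2 (frag_extend h c) = extend2 (\<lambda>x. reduce2 (h x)) (reduce2 c)"
proof -
  have "Poly_Mapping.keys c \<subseteq> UNIV" by simp
  then show ?thesis
  proof (rule frag_induction)
    show "reduce2 (frag_extend h 0) = extend2 (\<lambda>x. reduce2 (h x)) (reduce2 0)" by simp
  next
    fix a b
    assume *: "reduce2 (frag_extend h a) = extend2 (\<lambda>x. reduce2 (h x)) (reduce2 a)"
      "reduce2 (frag_extend h b) = extend2 (\<lambda>x. reduce2 (h x)) (reduce2 b)"
    then show "reduce2 (frag_extend h (a - b)) = extend2 (\<lambda>x. reduce2 (h x)) (reduce2 (a - b))"
      by (simp add: frag_extend_diff reduce2_diff diff_poly2 extend2_add)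
  qed simp
qed

lemma reduce2_boundary: "reduce2 (chain_boundary k c) = chain_boundary2 k (reduce2 c)"
  by (simp add: chain_boundary_def chain_boundary2_def reduce2_extend reduce2_sum)

lemma reduce2_chain_map: "reduce2 (chain_map k h c) = chain_map2 k h (reduce2 c)"
  by (simp add: chain_map_def chain_map2_def reduce2_extend)

lemma reduce2_surj:
  obtains c' where "c = reduce2 c'" "Poly_Mapping.keys c' = Poly_Mapping.keys c"
proof
  let ?c = "Poly_Mapping.map (\<lambda>_. 1::int) c"
  have l: "Poly_Mapping.lookup ?c x = (if Poly_Mapping.lookup c x = 0 then 0 else 1)" for x
    by (simp add: Poly_Mapping.map.rep_eq when_def)
  show "c = reduce2 ?c" by (rule poly_mapping_eqI, unfold lookup_reduce2 l) (simp split: if_split)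
  show "Poly_Mapping.keys ?c = Poly_Mapping.keys c" by (auto simp: in_keys_iff l split: if_split_asm)
qed

lemma keys_reduce2: "Poly_Mapping.keys (reduce2 c) \<subseteq> Poly_Mapping.keys c"
  by (auto simp: in_keys_iff)

lemma singular_chain2_boundary:
  assumes "singular_chain2 k X c" shows "singular_chain2 (k - 1) X (chain_boundary2 k c)"
proof -
  obtain c' where c': "c = reduce2 c'" "Poly_Mapping.keys c' = Poly_Mapping.keys c" by (rule reduce2_surj)
  then have "singular_chain k X c'" using assms by (simp add: singular_chain2_def singular_chain_def)
  then have "singular_chain (k - 1) X (chain_boundary k c')" using singular_chain_boundary by auto
  then show ?thesis
    using keys_reduce2 [of "chain_boundary k c'"]
    by (simp add: c'(1) reduce2_boundary [symmetric] singular_chain2_def singular_chain_def)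
qed

lemma boundary2_boundary2:
  assumes "singular_chain2 (Suc k) X c" shows "chain_boundary2 k (chain_boundary2 (Suc k) c) = 0"
proof -
  obtain c' where c': "c = reduce2 c'" "Poly_Mapping.keys c' = Poly_Mapping.keys c" by (rule reduce2_surj)
  then have "singular_chain (Suc k) X c'" using assms by (simp add: singular_chain2_def singular_chain_def)
  then have "chain_boundary k (chain_boundary (Suc k) c') = 0"
    using chain_boundary_boundary by fastforce
  then show ?thesis by (metis c'(1) reduce2_0 reduce2_boundary)
qed

lemma chain_map2_id:
  assumes "singular_chain2 k X c" shows "chain_map2 k id c = c"
proof -
  obtain c' where c': "c = reduce2 c'" "Poly_Mapping.keys c' = Poly_Mapping.keys c" by (rule reduce2_surj)
  then have "singular_chain k X c'" using assms by (simp add: singular_chain2_def singular_chain_def)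
  then have "chain_map k id c' = c'" by (rule chain_map_id_gen) simp
  then show ?thesis by (metis c'(1) reduce2_chain_map)
qed

lemma relcycle2_0: "relcycle2 k X S 0"
  by (simp add: relcycle2_def)
lemma relcycle2_add: "relcycle2 k X S c \<Longrightarrow> relcycle2 k X S d \<Longrightarrow> relcycle2 k X S (c + d)"
  by (simp add: relcycle2_def boundary2_add singular_chain2_add)

lemma singular_chain2_mono:
  "singular_chain2 k (subtopology X S) c \<Longrightarrow> S \<subseteq> T \<Longrightarrow> singular_chain2 k (subtopology X T) c"
  unfolding singular_chain2_def
  by (metis (mono_tags, lifting) singular_simplex_mono Collect_mono_iff subset_trans)

lemma singular_chain2_sub:
  "singular_chain2 k (subtopology X S) c \<Longrightarrow> singular_chain2 k X c"
  by (metis singular_chain2_mono subset_UNIV subtopology_UNIV)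

lemma relboundary2_0: "relboundary2 k X S 0"
  unfolding relboundary2_def by (rule exI [of _ 0]) simp
lemma relboundary2_add:
  assumes "relboundary2 k X S c" "relboundary2 k X S d" shows "relboundary2 k X S (c + d)"
proof -
  obtain a b where "singular_chain2 (Suc k) X a" "singular_chain2 (Suc k) X b" 
    and "singular_chain2 k (subtopology X S) (chain_boundary2 (Suc k) a - c)"
      "singular_chain2 k (subtopology X S) (chain_boundary2 (Suc k) b - d)"
    using assms unfolding relboundary2_def by blast
  then have "singular_chain2 (Suc k) X (a + b)"
    "singular_chain2 k (subtopology X S) (chain_boundary2 (Suc k) (a + b) - (c + d))"
    using singular_chain2_add [of k _ "chain_boundary2 (Suc k) a - c" "chain_boundary2 (Suc k) b - d"]
    by (auto simp: singular_chain2_add boundary2_add algebra_simps)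
  then show ?thesis unfolding relboundary2_def by blast
qed

lemma relboundary2_imp_relcycle2:
  assumes "relboundary2 k X S c" shows "relcycle2 k X S c"
proof -
  obtain d where d: "singular_chain2 (Suc k) X d"
    and e: "singular_chain2 k (subtopology X S) (chain_boundary2 (Suc k) d - c)"
    using assms unfolding relboundary2_def by blast
  define u where "u = chain_boundary2 (Suc k) d - c"
  have c: "c = chain_boundary2 (Suc k) d + u"
    by (simp add: u_def diff_poly2 add.assoc [symmetric])
  have u: "singular_chain2 k (subtopology X S) u" using e by (simp add: u_def)
  have "singular_chain2 k X (chain_boundary2 (Suc k) d)" 
    using singular_chain2_boundary [OF d] by simp
  then have "singular_chain2 k X c" using u unfolding c by (blast intro: singular_chain2_add singular_chain2_sub)
  moreover have "chain_boundary2 k c = chain_boundary2 k u"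
    unfolding c by (simp add: boundary2_add boundary2_boundary2 [OF d])
  ultimately show ?thesis
    using singular_chain2_boundary [OF u] by (simp add: relcycle2_def)
qed

lemma class_field_bit: "Ring.field F2"
  unfolding F2_def by (rule class_field.field_axioms)

lemma vectorspaceI: "Module.module F2 V \<Longrightarrow> vectorspace F2 V"
  by (simp add: vectorspace_def class_field_bit)

lemma class_cring_bit: "cring F2"
  unfolding F2_def by (rule class_cring.cring_axioms)

lemma F2_sel [simp]: "carrier F2 = UNIV" "one F2 = 1"
  by (simp_all add: F2_def)
lemma F2_ops: "add F2 = (+)" "mult F2 = (*)"
  by (simp_all add: F2_def)

lemma relcycle_space_sel [simp]:
  "carrier (relcycle_space k X S) = Collect (relcycle2 k X S)"
  "zero (relcycle_space k X S) = 0"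
  "add (relcycle_space k X S) = (+)"
  "module.smult (relcycle_space k X S) = scale2"
  by (simp_all add: relcycle_space_def)

lemma abelian_group_relcycle: "abelian_group (relcycle_space k X S)"
  by (rule abelian_groupI) (auto simp: relcycle2_add relcycle2_0 algebra_simps intro: add_self_poly2)

lemma relcycle2_scale: "relcycle2 k X S c \<Longrightarrow> relcycle2 k X S (scale2 r c)"
  by (cases r) (auto simp: relcycle2_0)

lemma module_relcycle: "Module.module F2 (relcycle_space k X S)"
  by (rule Module.moduleI [OF class_cring_bit abelian_group_relcycle])
     (auto simp only: F2_sel F2_ops relcycle_space_sel mem_Collect_eq relcycle2_scale scale2_add scale2_add_left scale2_scale2 scale2_1)

lemma module_quotient:
  assumes m: "Module.module F2 V" and N: "additive_subgroup N V"
    and sm: "\<And>r x. x \<in> N \<Longrightarrow> r \<odot>\<^bsub>V\<^esub> x \<in> N"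
  shows "Module.module F2 (quotient_space V N)"
    and "\<And>r x. x \<in> carrier V \<Longrightarrow> r \<odot>\<^bsub>quotient_space V N\<^esub> (N +>\<^bsub>V\<^esub> x) = N +>\<^bsub>V\<^esub> (r \<odot>\<^bsub>V\<^esub> x)"
proof -
  interpret V: Module.module F2 V by (rule m)
  interpret N: abelian_subgroup N V by (rule abelian_subgroupI3 [OF N V.abelian_group_axioms])
  let ?Q = "quotient_space V N"
  have cos: "A \<in> carrier ?Q \<longleftrightarrow> (\<exists>x\<in>carrier V. A = N +>\<^bsub>V\<^esub> x)" for A
    by (auto simp: quotient_space_def A_RCOSETS_def')
  have add: "(N +>\<^bsub>V\<^esub> x) \<oplus>\<^bsub>?Q\<^esub> (N +>\<^bsub>V\<^esub> y) = N +>\<^bsub>V\<^esub> (x \<oplus>\<^bsub>V\<^esub> y)"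
    if "x \<in> carrier V" "y \<in> carrier V" for x y
    using N.a_rcos_sum that by (simp add: quotient_space_def)
  have Q0: "\<zero>\<^bsub>?Q\<^esub> = N +>\<^bsub>V\<^esub> \<zero>\<^bsub>V\<^esub>"
    using V.a_coset_add_zero N.a_subset by (simp add: quotient_space_def)
  have ab: "abelian_group ?Q"
  proof (rule abelian_groupI)
    fix x assume "x \<in> carrier ?Q"
    then obtain u where u: "u \<in> carrier V" "x = N +>\<^bsub>V\<^esub> u" using cos by blast
    then have "(N +>\<^bsub>V\<^esub> (\<ominus>\<^bsub>V\<^esub> u)) \<oplus>\<^bsub>?Q\<^esub> x = \<zero>\<^bsub>?Q\<^esub>"
      by (simp add: add Q0 V.M.l_neg)
    then show "\<exists>y\<in>carrier ?Q. y \<oplus>\<^bsub>?Q\<^esub> x = \<zero>\<^bsub>?Q\<^esub>"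
      using u cos V.M.a_inv_closed by metis
  next
    show "\<zero>\<^bsub>?Q\<^esub> \<in> carrier ?Q" unfolding Q0 cos by blast
  next
    fix x y assume "x \<in> carrier ?Q" "y \<in> carrier ?Q"
    then show "x \<oplus>\<^bsub>?Q\<^esub> y \<in> carrier ?Q" unfolding cos by (metis add V.M.a_closed)
  qed (auto simp: cos add Q0 V.M.a_ac)
  show smu: "r \<odot>\<^bsub>?Q\<^esub> (N +>\<^bsub>V\<^esub> x) = N +>\<^bsub>V\<^esub> (r \<odot>\<^bsub>V\<^esub> x)" if x: "x \<in> carrier V" for r x
  proof -
    have "N <+>\<^bsub>V\<^esub> ((\<lambda>v. r \<odot>\<^bsub>V\<^esub> v) ` (N +>\<^bsub>V\<^esub> x)) = N +>\<^bsub>V\<^esub> (r \<odot>\<^bsub>V\<^esub> x)" (is "?L = ?R")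
    proof (intro Set.set_eqI iffI)
      fix z assume "z \<in> ?L"
      then obtain n m where nm: "n \<in> N" "m \<in> N" "z = n \<oplus>\<^bsub>V\<^esub> (r \<odot>\<^bsub>V\<^esub> (m \<oplus>\<^bsub>V\<^esub> x))"
        by (auto simp: set_add_def' a_r_coset_def')
      have "m \<in> carrier V" "n \<in> carrier V" using nm N.a_subset by auto
      then have "z = (n \<oplus>\<^bsub>V\<^esub> r \<odot>\<^bsub>V\<^esub> m) \<oplus>\<^bsub>V\<^esub> (r \<odot>\<^bsub>V\<^esub> x)"
        using x V.smult_r_distr [of r m x] V.smult_closed [of r] by (simp add: nm(3) V.M.a_assoc)
      moreover have "n \<oplus>\<^bsub>V\<^esub> r \<odot>\<^bsub>V\<^esub> m \<in> N" using nm sm N.a_closed by auto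
      ultimately show "z \<in> ?R" by (auto simp: a_r_coset_def')
    next
      fix z assume "z \<in> ?R"
      then obtain n where n: "n \<in> N" "z = n \<oplus>\<^bsub>V\<^esub> (r \<odot>\<^bsub>V\<^esub> x)" by (auto simp: a_r_coset_def')
      moreover have "x \<in> N +>\<^bsub>V\<^esub> x" using N.a_rcos_self x by blast
      ultimately show "z \<in> ?L" by (auto simp: set_add_def')
    qed
    then show ?thesis by (simp add: quotient_space_def)
  qed
  show "Module.module F2 ?Q"
  proof (rule Module.moduleI [OF class_cring_bit ab])
    fix a x assume "x \<in> carrier ?Q" then show "a \<odot>\<^bsub>?Q\<^esub> x \<in> carrier ?Q"
      using V.smult_closed [of a] unfolding cos by (metis smu UNIV_I F2_sel(1))
  next
    fix a b x assume "x \<in> carrier ?Q"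
    then show "(a \<oplus>\<^bsub>F2\<^esub> b) \<odot>\<^bsub>?Q\<^esub> x = a \<odot>\<^bsub>?Q\<^esub> x \<oplus>\<^bsub>?Q\<^esub> b \<odot>\<^bsub>?Q\<^esub> x"
      using V.smult_closed V.smult_l_distr unfolding cos by (auto simp: smu add)
  next
    fix a x y assume "x \<in> carrier ?Q" "y \<in> carrier ?Q"
    then show "a \<odot>\<^bsub>?Q\<^esub> (x \<oplus>\<^bsub>?Q\<^esub> y) = a \<odot>\<^bsub>?Q\<^esub> x \<oplus>\<^bsub>?Q\<^esub> a \<odot>\<^bsub>?Q\<^esub> y"
      using V.smult_closed V.smult_r_distr unfolding cos by (auto simp: smu add)
  next
    fix a b x assume "x \<in> carrier ?Q"
    then show "(a \<otimes>\<^bsub>F2\<^esub> b) \<odot>\<^bsub>?Q\<^esub> x = a \<odot>\<^bsub>?Q\<^esub> (b \<odot>\<^bsub>?Q\<^esub> x)"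
      using V.smult_closed V.smult_assoc1 unfolding cos by (auto simp: smu)
  next
    fix x assume "x \<in> carrier ?Q"
    then show "\<one>\<^bsub>F2\<^esub> \<odot>\<^bsub>?Q\<^esub> x = x"
      using V.smult_one unfolding cos by (auto simp: smu)
  qed
qed

abbreviation coset2 where "coset2 k X S c \<equiv> Collect (relboundary2 k X S) +>\<^bsub>relcycle_space k X S\<^esub> c"

lemma additive_subgroup_relboundary:
  "additive_subgroup (Collect (relboundary2 k X S)) (relcycle_space k X S)"
proof -
  interpret abelian_group "relcycle_space k X S" by (rule abelian_group_relcycle)
  have "a_inv (relcycle_space k X S) c = c" if "relcycle2 k X S c" for c
    by (rule minus_equality) (use that in auto)
  then show ?thesis
    unfolding additive_subgroup_def
    by (intro group.subgroupI a_group)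
       (auto simp: relboundary2_imp_relcycle2 relboundary2_add a_inv_def intro: relboundary2_0)
qed

lemma relboundary2_scale: "relboundary2 k X S c \<Longrightarrow> relboundary2 k X S (scale2 r c)"
  by (cases r) (auto simp: relboundary2_0)

lemma vectorspace_homology2: "vectorspace F2 (homology2 k X S)"
  unfolding homology2_def
  by (intro vectorspaceI module_quotient module_relcycle additive_subgroup_relboundary)
     (simp add: relboundary2_scale)

lemma coset2_eq: "coset2 k X S c = {u + c |u. relboundary2 k X S u}"
  by (auto simp: a_r_coset_def')

lemma carrier_homology2: "carrier (homology2 k X S) = {coset2 k X S c | c. relcycle2 k X S c}"
  by (auto simp: homology2_def quotient_space_def A_RCOSETS_def')

lemma homology2_add: "relcycle2 k X S c \<Longrightarrow> relcycle2 k X S d \<Longrightarrow>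
  coset2 k X S c \<oplus>\<^bsub>homology2 k X S\<^esub> coset2 k X S d = coset2 k X S (c + d)"
  using abelian_subgroup.a_rcos_sum [OF abelian_subgroupI3 [OF additive_subgroup_relboundary abelian_group_relcycle], of c k X S d]
  by (simp add: homology2_def quotient_space_def)

lemma homology2_smult: "relcycle2 k X S c \<Longrightarrow>
  r \<odot>\<^bsub>homology2 k X S\<^esub> coset2 k X S c = coset2 k X S (scale2 r c)"
  using module_quotient(2) [OF module_relcycle additive_subgroup_relboundary, of k X S c r]
  by (simp add: homology2_def relboundary2_scale)

lemma hom_induced2_incl:
  assumes le: "\<And>c. relboundary2 k X S c \<Longrightarrow> relboundary2 k Y T c" and c: "relcycle2 k X S c"
  shows "hom_induced2 k Y T id (coset2 k X S c) = coset2 k Y T c"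
proof -
  have "chain_map2 k id z = z" if "z \<in> coset2 k X S c" for z
  proof -
    have "relcycle2 k X S z" using that c relboundary2_imp_relcycle2 relcycle2_add by (fastforce simp: coset2_eq)
    then show ?thesis using chain_map2_id by (auto simp: relcycle2_def)
  qed
  then have "chain_map2 k id ` coset2 k X S c = coset2 k X S c" by simp
  then have "hom_induced2 k Y T id (coset2 k X S c) = Collect (relboundary2 k Y T) <+>\<^bsub>relcycle_space k Y T\<^esub> coset2 k X S c"
    by (simp add: hom_induced2_def)
  also have "\<dots> = {v + (u + c) | u v. relboundary2 k Y T v \<and> relboundary2 k X S u}"
    by (auto simp: set_add_def' coset2_eq)
  also have "\<dots> = coset2 k Y T c"
  proof -
    have "\<exists>w. v + (u + c) = w + c \<and> relboundary2 k Y T w" if "relboundary2 k Y T v" "relboundary2 k X S u" for u v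
      using that le relboundary2_add by (metis add.assoc)
    moreover have "\<exists>u v. w + c = v + (u + c) \<and> relboundary2 k Y T v \<and> relboundary2 k X S u" if "relboundary2 k Y T w" for w
      using that relboundary2_0 by (metis add_0)
    ultimately show ?thesis by (auto simp: coset2_eq)
  qed
  finally show ?thesis .
qed

definition sub_pair where "sub_pair P Q \<longleftrightarrow> (\<exists>Z A B. fst P = subtopology Z A \<and> fst Q = subtopology Z B \<and> A \<subseteq> B \<and> snd P \<subseteq> snd Q)"

lemma sub_pair_chain: assumes "sub_pair P Q"
  shows "singular_chain2 k (fst P) c \<Longrightarrow> singular_chain2 k (fst Q) c"
    "singular_chain2 k (subtopology (fst P) (snd P)) c \<Longrightarrow> singular_chain2 k (subtopology (fst Q) (snd Q)) c"
proof -
  obtain Z A B where *: "fst P = subtopology Z A" "fst Q = subtopology Z B" "A \<subseteq> B" "snd P \<subseteq> snd Q"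
    using assms unfolding sub_pair_def by blast
  show "singular_chain2 k (fst P) c \<Longrightarrow> singular_chain2 k (fst Q) c"
    using * singular_chain2_mono by metis
  have "A \<inter> snd P \<subseteq> B \<inter> snd Q" using * by blast
  then show "singular_chain2 k (subtopology (fst P) (snd P)) c \<Longrightarrow> singular_chain2 k (subtopology (fst Q) (snd Q)) c"
    using * by (metis singular_chain2_mono subtopology_subtopology)
qed

lemma sub_pair_rel: assumes "sub_pair P Q"
  shows "relcycle2 k (fst P) (snd P) c \<Longrightarrow> relcycle2 k (fst Q) (snd Q) c"
    "relboundary2 k (fst P) (snd P) c \<Longrightarrow> relboundary2 k (fst Q) (snd Q) c"
  using sub_pair_chain [OF assms] unfolding relcycle2_def relboundary2_def by blast+

lemma linear_map_incl:
  assumes "sub_pair P Q"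
  shows "linear_map F2 (homology2 k (fst P) (snd P)) (homology2 k (fst Q) (snd Q)) (hom_induced2 k (fst Q) (snd Q) id)"
proof -
  note * = hom_induced2_incl [OF sub_pair_rel(2) [OF assms]]
  note mod = vectorspace_homology2 [unfolded vectorspace_def, THEN conjunct1]
  show ?thesis
    unfolding linear_map_def mod_hom_def mod_hom_axioms_def
    apply (intro conjI vectorspace_homology2 mod)
    using sub_pair_rel(1) [OF assms]
    by (auto simp: LinearCombinations.module_hom_def carrier_homology2 * homology2_add homology2_smult relcycle2_add relcycle2_scale)
qed

lemma is_diagram_homology:
  assumes "\<And>a b. a \<le> b \<Longrightarrow> sub_pair (P a) (P b)"
  shows "is_diagram (homology_diagram k P)"
  unfolding is_diagram_def homology_diagram_def
proof (simp only: diagram.simps, intro conjI allI impI ballI)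
  show "vectorspace F2 (homology2 k (fst (P a)) (snd (P a)))" for a by (rule vectorspace_homology2)
  show "a \<le> b \<Longrightarrow> linear_map F2 (homology2 k (fst (P a)) (snd (P a))) (homology2 k (fst (P b)) (snd (P b)))
           (hom_induced2 k (fst (P b)) (snd (P b)) id)" for a b
    by (rule linear_map_incl [OF assms])
  show "hom_induced2 k (fst (P a)) (snd (P a)) id x = x" 
    if "x \<in> carrier (homology2 k (fst (P a)) (snd (P a)))" for a x
    using that hom_induced2_incl by (fastforce simp: carrier_homology2)
  show "hom_induced2 k (fst (P c)) (snd (P c)) id (hom_induced2 k (fst (P b)) (snd (P b)) id x) =
       hom_induced2 k (fst (P c)) (snd (P c)) id x"
    if "a \<le> b" "b \<le> c" "x \<in> carrier (homology2 k (fst (P a)) (snd (P a)))" for a b c x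
  proof -
    have ab: "sub_pair (P a) (P b)" and bc: "sub_pair (P b) (P c)" and ac: "sub_pair (P a) (P c)" using that assms by auto
    show ?thesis
    using that hom_induced2_incl [OF sub_pair_rel(2) [OF ab]] hom_induced2_incl [OF sub_pair_rel(2) [OF bc]]
      hom_induced2_incl [OF sub_pair_rel(2) [OF ac]] sub_pair_rel(1) [OF ab]
    by (auto simp: carrier_homology2)
  qed
qed

lemma sub_pair_bi: "a \<le> b \<Longrightarrow> sub_pair (bifiltration M X f a) (bifiltration M X f b)"
  unfolding sub_pair_def bifiltration_def
  by (rule exI [of _ X], rule exI [of _ "sublevel_set X f a"], rule exI [of _ "sublevel_set X f b"])
     (auto simp: sublevel_set_def superlevel_set_def)

lemma sub_pair_sub: "a \<le> b \<Longrightarrow> sub_pair (sublevel_filtration X f a) (sublevel_filtration X f b)"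
  unfolding sub_pair_def sublevel_filtration_def
  by (rule exI [of _ X], rule exI [of _ "sublevel_set X f a"], rule exI [of _ "sublevel_set X f b"])
     (auto simp: sublevel_set_def)

theorem is_diagram_sublevel: "is_diagram (homology_diagram k (sublevel_filtration X f))"
  by (intro is_diagram_homology sub_pair_sub)

theorem is_diagram_bifiltration: "is_diagram (homology_diagram k (bifiltration M X f))"
  by (intro is_diagram_homology sub_pair_bi)

lemma linear_map_restrict:
  assumes "linear_map F2 V W T" "subspace F2 A V" "subspace F2 B W" "T ` A \<subseteq> B"
  shows "linear_map F2 (V\<lparr>carrier := A\<rparr>) (W\<lparr>carrier := B\<rparr>) T"
proof -
  interpret linear_map F2 V W T by fact
  have "vectorspace F2 (V\<lparr>carrier := A\<rparr>)" "vectorspace F2 (W\<lparr>carrier := B\<rparr>)"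
    using assms V.subspace_is_vs W.subspace_is_vs by auto
  moreover have "A \<subseteq> carrier V" using assms(2) by (simp add: VectorSpace.subspace_def submodule_def)
  ultimately show ?thesis using assms(4) f_hom
    unfolding linear_map_def mod_hom_def mod_hom_axioms_def vectorspace_def
    by (auto simp: LinearCombinations.module_hom_def subset_iff)
qed

lemma is_diagram_persistent:
  assumes D: "is_diagram D" and p: "0 \<le> p"
  shows "is_diagram (persistent_image p D)"
proof -
  let ?I = "\<lambda>a. Mor D a (a + p) ` carrier (Ob D a)"
  have lin: "linear_map F2 (Ob D a) (Ob D b) (Mor D a b)" if "a \<le> b" for a b
    using D that by (auto simp: is_diagram_def)
  have comp: "Mor D b c (Mor D a b x) = Mor D a c x" if "a \<le> b" "b \<le> c" "x \<in> carrier (Ob D a)" for a b c x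
    using D that by (auto simp: is_diagram_def)
  have idn: "Mor D a a x = x" if "x \<in> carrier (Ob D a)" for a x
    using D that by (auto simp: is_diagram_def)
  have cl: "Mor D a b x \<in> carrier (Ob D b)" if "a \<le> b" "x \<in> carrier (Ob D a)" for a b x
    using lin [OF that(1)] that(2) unfolding linear_map_def mod_hom_def mod_hom_axioms_def
    by (auto simp: LinearCombinations.module_hom_def)
  have sub: "subspace F2 (?I a) (Ob D (a + p))" for a
  proof -
    interpret linear_map F2 "Ob D a" "Ob D (a + p)" "Mor D a (a + p)" by (rule lin) (use p in simp)
    show ?thesis using imT_is_subspace by (simp add: im_def)
  qed
  have im: "Mor D (a + p) (b + p) ` ?I a \<subseteq> ?I b" if "a \<le> b" for a b
  proof clarify
    fix x assume x: "x \<in> carrier (Ob D a)"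
    have "Mor D (a + p) (b + p) (Mor D a (a + p) x) = Mor D b (b + p) (Mor D a b x)"
      using comp x that p by simp
    then show "Mor D (a + p) (b + p) (Mor D a (a + p) x) \<in> ?I b" using cl that x by simp
  qed
  have "vectorspace F2 ((Ob D (a + p))\<lparr>carrier := ?I a\<rparr>)" for a
    using linear_map_restrict [OF lin sub sub im, of a a]
    by (simp add: linear_map_def)
  then show ?thesis
    unfolding is_diagram_def persistent_image_def
    using linear_map_restrict [OF lin sub sub im] comp idn cl p
    by simp
qed

theorem is_diagram_extended:
  "0 \<le> p \<Longrightarrow> is_diagram (extended_persistent_homology p k M X f)"
  unfolding extended_persistent_homology_def
  by (intro is_diagram_persistent is_diagram_bifiltration)

theorem bifiltration_pair:
  assumes "f \<in> topspace X \<rightarrow> {-M<..<M}"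
  shows "snd (bifiltration M X f a) \<subseteq> topspace (fst (bifiltration M X f a))"
proof
  fix x assume "x \<in> snd (bifiltration M X f a)"
  then have x: "x \<in> topspace X" "2 * M + 1 - a \<le> f x"
    by (auto simp: bifiltration_def superlevel_set_def)
  then have "f x < M" using assms by auto
  then have "f x \<le> a" using x(2) by simp
  then show "x \<in> topspace (fst (bifiltration M X f a))"
    using x(1) by (simp add: bifiltration_def sublevel_set_def)
qed


end

(* Write e for the sup norm of f - g. Since |f - g| <= e pointwise, the pair of the bifiltration
   of f at level a is contained in the pair of the bifiltration of g at level a + e, and
   conversely. The maps induced by these inclusions form an e-interleaving of the homology
   diagrams because all composites of inclusions agree, and any interleaving of two diagrams
   restricts to their persistent images. *)
theory Submission
  imports Defs
begin

text \<open>A class in \<open>P\<close> has a relative cycle \<open>c\<close> as representative, and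
  a map induced by an inclusion keeps \<open>c\<close>. Both sides are therefore the class of
  \<open>c\<close> in \<open>R\<close>.\<close>

lemma hom_induced2_incl_comp:
  assumes "sub_pair P Q" "sub_pair Q R" "x \<in> carrier (homology2 k (fst P) (snd P))"
  shows "hom_induced2 k (fst R) (snd R) id (hom_induced2 k (fst Q) (snd Q) id x)
    = hom_induced2 k (fst R) (snd R) id x"
proof -
  obtain c where c: "relcycle2 k (fst P) (snd P) c" and x: "x = coset2 k (fst P) (snd P) c"
    using assms(3) by (auto simp: carrier_homology2)
  note PQ = sub_pair_rel [OF assms(1)] and QR = sub_pair_rel [OF assms(2)]
  \<comment> \<open>Relative boundaries of \<open>P\<close> become relative boundaries of
    \<open>R\<close> by passing through \<open>Q\<close>.\<close>
  have "hom_induced2 k (fst R) (snd R) id x = coset2 k (fst R) (snd R) c"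
    unfolding x using PQ(2) QR(2) c by (intro hom_induced2_incl) auto
  moreover have "hom_induced2 k (fst Q) (snd Q) id x = coset2 k (fst Q) (snd Q) c"
    unfolding x using PQ(2) c by (intro hom_induced2_incl) auto
  moreover have "hom_induced2 k (fst R) (snd R) id (coset2 k (fst Q) (snd Q) c)
      = coset2 k (fst R) (snd R) c"
    using QR(2) PQ(1) c by (intro hom_induced2_incl) auto
  ultimately show ?thesis by simp
qed

text \<open>Both ways round the naturality square, through \<open>P b\<close> and through
  \<open>Q (a + \<epsilon>)\<close>, are composites of inclusions from \<open>P a\<close> to
  \<open>Q (b + \<epsilon>)\<close>, so they induce the same map.\<close>

lemma natural_transformation_homology:
  assumes P: "\<And>a b. a \<le> b \<Longrightarrow> sub_pair (P a) (P b)"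
    and Q: "\<And>a b. a \<le> b \<Longrightarrow> sub_pair (Q a) (Q b)"
    and PQ: "\<And>a. sub_pair (P a) (Q (a + \<epsilon>))"
  shows "natural_transformation (homology_diagram k P) (shift \<epsilon> (homology_diagram k Q))
    (\<lambda>a. hom_induced2 k (fst (Q (a + \<epsilon>))) (snd (Q (a + \<epsilon>))) id)"
proof -
  have "hom_induced2 k (fst (Q (b + \<epsilon>))) (snd (Q (b + \<epsilon>))) id
          (hom_induced2 k (fst (P b)) (snd (P b)) id x)
      = hom_induced2 k (fst (Q (b + \<epsilon>))) (snd (Q (b + \<epsilon>))) id
          (hom_induced2 k (fst (Q (a + \<epsilon>))) (snd (Q (a + \<epsilon>))) id x)"
    if "a \<le> b" "x \<in> carrier (homology2 k (fst (P a)) (snd (P a)))" for a b x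
    using hom_induced2_incl_comp [OF P PQ that(2), of b]
      hom_induced2_incl_comp [OF PQ Q that(2), of "b + \<epsilon>"] that(1) by simp
  then show ?thesis
    using linear_map_incl [OF PQ]
    by (simp add: natural_transformation_def homology_diagram_def shift_def)
qed

lemma interleaved_homology:
  assumes P: "\<And>a b. a \<le> b \<Longrightarrow> sub_pair (P a) (P b)"
    and Q: "\<And>a b. a \<le> b \<Longrightarrow> sub_pair (Q a) (Q b)"
    and PQ: "\<And>a. sub_pair (P a) (Q (a + \<epsilon>))"
    and QP: "\<And>a. sub_pair (Q a) (P (a + \<epsilon>))"
  shows "interleaved \<epsilon> (homology_diagram k P) (homology_diagram k Q)"
proof -
  have two: "a + \<epsilon> + \<epsilon> = a + 2 * \<epsilon>" for a :: real by simp
  show ?thesis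
    unfolding interleaved_def
  proof (intro exI conjI allI ballI)
    show "natural_transformation (homology_diagram k P) (shift \<epsilon> (homology_diagram k Q))
        (\<lambda>a. hom_induced2 k (fst (Q (a + \<epsilon>))) (snd (Q (a + \<epsilon>))) id)"
      by (rule natural_transformation_homology) (fact P Q PQ)+
    show "natural_transformation (homology_diagram k Q) (shift \<epsilon> (homology_diagram k P))
        (\<lambda>a. hom_induced2 k (fst (P (a + \<epsilon>))) (snd (P (a + \<epsilon>))) id)"
      by (rule natural_transformation_homology) (fact P Q QP)+
  \<comment> \<open>What remains are the two triangle identities: going to the other filtration and
    back is again an inclusion.\<close>
  qed (use hom_induced2_incl_comp [OF PQ QP] hom_induced2_incl_comp [OF QP PQ] in
      \<open>simp_all add: homology_diagram_def two\<close>)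
qed

lemma subspace_persistent_image:
  assumes "is_diagram D" "0 \<le> p"
  shows "subspace F2 (Mor D a (a + p) ` carrier (Ob D a)) (Ob D (a + p))"
proof -
  interpret linear_map F2 "Ob D a" "Ob D (a + p)" "Mor D a (a + p)"
    using assms by (simp add: is_diagram_def)
  show ?thesis using imT_is_subspace by (simp add: im_def)
qed

lemma persistent_image_carrier:
  assumes "is_diagram D" "0 \<le> p"
  shows "carrier (Ob (persistent_image p D) a) \<subseteq> carrier (Ob D (a + p))"
  using subspace_persistent_image [OF assms, of a]
  by (simp add: persistent_image_def VectorSpace.subspace_def submodule_def)

text \<open>At index \<open>a\<close> the persistent image sits inside \<open>Ob D (a + p)\<close>,
  so the component there is the restriction of \<open>\<phi> (a + p)\<close>.\<close>

lemma natural_transformation_persistent_image: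
  assumes D: "is_diagram D" and E: "is_diagram E" and p: "0 \<le> p"
    and nt: "natural_transformation D (shift \<epsilon> E) \<phi>"
  shows "natural_transformation (persistent_image p D) (shift \<epsilon> (persistent_image p E))
    (\<lambda>a. \<phi> (a + p))"
proof -
  have lin: "linear_map F2 (Ob D a) (Ob E (a + \<epsilon>)) (\<phi> a)" for a
    using nt by (simp add: natural_transformation_def shift_def)
  have nat: "\<phi> b (Mor D a b x) = Mor E (a + \<epsilon>) (b + \<epsilon>) (\<phi> a x)"
    if "a \<le> b" "x \<in> carrier (Ob D a)" for a b x
    using nt that by (simp add: natural_transformation_def shift_def)
  have cl: "\<phi> a x \<in> carrier (Ob E (a + \<epsilon>))" if "x \<in> carrier (Ob D a)" for a x
    using lin [of a] that unfolding linear_map_def mod_hom_def mod_hom_axioms_def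
    by (auto simp: LinearCombinations.module_hom_def)
  \<comment> \<open>Objects are indexed by real terms: \<open>\<phi> (a + p)\<close> ends at
    \<open>a + p + \<epsilon>\<close>, the shifted image lives at
    \<open>a + \<epsilon> + p\<close>.\<close>
  have swap: "a + p + \<epsilon> = a + \<epsilon> + p" for a by simp
  \<comment> \<open>Naturality for \<open>a \<le> a + p\<close>: an element coming from
    \<open>x\<close> is sent to one coming from \<open>\<phi> a x\<close>, so images go to
    images.\<close>
  have "\<phi> (a + p) ` Mor D a (a + p) ` carrier (Ob D a)
      \<subseteq> Mor E (a + \<epsilon>) (a + \<epsilon> + p) ` carrier (Ob E (a + \<epsilon>))" for a
    using nat [of a "a + p"] cl [of _ a] p by (auto simp: swap)
  then have "linear_map F2 (Ob (persistent_image p D) a) (Ob (persistent_image p E) (a + \<epsilon>))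
      (\<phi> (a + p))" for a
    using linear_map_restrict [OF lin [of "a + p", unfolded swap]
        subspace_persistent_image [OF D p] subspace_persistent_image [OF E p]]
    by (simp add: persistent_image_def)
  moreover have "\<phi> (b + p) (Mor (persistent_image p D) a b x)
      = Mor (persistent_image p E) (a + \<epsilon>) (b + \<epsilon>) (\<phi> (a + p) x)"
    if "a \<le> b" "x \<in> carrier (Ob (persistent_image p D) a)" for a b x
    using nat [of "a + p" "b + p" x] that persistent_image_carrier [OF D p, of a]
    by (auto simp: persistent_image_def swap)
  ultimately show ?thesis
    by (simp add: natural_transformation_def shift_def)
qed

lemma interleaved_persistent_image:
  assumes D: "is_diagram D" and E: "is_diagram E" and p: "0 \<le> p"
    and "interleaved \<epsilon> D E"
  shows "interleaved \<epsilon> (persistent_image p D) (persistent_image p E)"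
proof -
  obtain \<phi> \<psi> where \<phi>: "natural_transformation D (shift \<epsilon> E) \<phi>"
    and \<psi>: "natural_transformation E (shift \<epsilon> D) \<psi>"
    and \<psi>\<phi>: "\<And>a x. x \<in> carrier (Ob D a) \<Longrightarrow> \<psi> (a + \<epsilon>) (\<phi> a x) = Mor D a (a + 2 * \<epsilon>) x"
    and \<phi>\<psi>: "\<And>a y. y \<in> carrier (Ob E a) \<Longrightarrow> \<phi> (a + \<epsilon>) (\<psi> a y) = Mor E a (a + 2 * \<epsilon>) y"
    using assms(4) unfolding interleaved_def by blast
  show ?thesis
    unfolding interleaved_def
  proof (intro exI conjI allI ballI)
    show "natural_transformation (persistent_image p D) (shift \<epsilon> (persistent_image p E))
        (\<lambda>a. \<phi> (a + p))"
      by (rule natural_transformation_persistent_image [OF D E p \<phi>])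
    show "natural_transformation (persistent_image p E) (shift \<epsilon> (persistent_image p D))
        (\<lambda>a. \<psi> (a + p))"
      by (rule natural_transformation_persistent_image [OF E D p \<psi>])
    \<comment> \<open>This is the triangle identity of \<open>D\<close> at level
      \<open>a + p\<close>, evaluated on elements of the image.\<close>
    show "\<psi> (a + \<epsilon> + p) (\<phi> (a + p) x) = Mor (persistent_image p D) a (a + 2 * \<epsilon>) x"
      if "x \<in> carrier (Ob (persistent_image p D) a)" for a x
      using \<psi>\<phi> [of x "a + p"] that persistent_image_carrier [OF D p, of a]
      by (auto simp: persistent_image_def algebra_simps)
    show "\<phi> (a + \<epsilon> + p) (\<psi> (a + p) y) = Mor (persistent_image p E) a (a + 2 * \<epsilon>) y"
      if "y \<in> carrier (Ob (persistent_image p E) a)" for a y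
      using \<phi>\<psi> [of y "a + p"] that persistent_image_carrier [OF E p, of a]
      by (auto simp: persistent_image_def algebra_simps)
  qed
qed

text \<open>From \<open>f x \<le> a\<close> follows \<open>g x \<le> a + \<epsilon>\<close>. The
  superlevel threshold falls as the index grows, so \<open>2 * M + 1 - a \<le> f x\<close> likewise
  gives \<open>2 * M + 1 - (a + \<epsilon>) \<le> g x\<close>.\<close>

lemma sub_pair_bifiltration:
  assumes "\<And>x. x \<in> topspace X \<Longrightarrow> \<bar>f x - g x\<bar> \<le> \<epsilon>"
  shows "sub_pair (bifiltration M X f a) (bifiltration M X g (a + \<epsilon>))"
  unfolding sub_pair_def
proof (intro exI conjI)
  show "fst (bifiltration M X f a) = subtopology X (sublevel_set X f a)"
    "fst (bifiltration M X g (a + \<epsilon>)) = subtopology X (sublevel_set X g (a + \<epsilon>))"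
    by (simp_all add: bifiltration_def)
  show "sublevel_set X f a \<subseteq> sublevel_set X g (a + \<epsilon>)"
    "snd (bifiltration M X f a) \<subseteq> snd (bifiltration M X g (a + \<epsilon>))"
    using assms by (fastforce simp: bifiltration_def sublevel_set_def superlevel_set_def)+
qed

theorem theorem4p1p1:
  fixes X :: "'a topology" and f g :: "'a \<Rightarrow> real" and M p :: real and k :: nat
  assumes "0 < M" and "bounded_tame M X f" and "bounded_tame M X g" and "0 \<le> p"
  shows "interleaving_distance (extended_persistent_homology p k M X f)
             (extended_persistent_homology p k M X g)
           \<le> (SUP x\<in>topspace X. ennreal \<bar>f x - g x\<bar>)"
proof -
  let ?S = "SUP x\<in>topspace X. ennreal \<bar>f x - g x\<bar>"
  \<comment> \<open>A uniform bound makes the supremum finite, hence a real number that can serve as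
    a shift.\<close>
  have "\<bar>f x - g x\<bar> \<le> 2 * M" if "x \<in> topspace X" for x
  proof -
    have "f x \<in> {-M<..<M}" "g x \<in> {-M<..<M}"
      using assms(2,3) that unfolding bounded_tame_def by blast+
    then show ?thesis by auto
  qed
  then have "?S \<le> ennreal (2 * M)"
    by (intro SUP_least ennreal_leI)
  \<comment> \<open>The bound excludes the value \<open>top\<close>; for empty \<open>X\<close> the
    supremum in \<open>ennreal\<close> is 0.\<close>
  then obtain \<epsilon> where \<epsilon>: "0 \<le> \<epsilon>" "?S = ennreal \<epsilon>"
    by (cases ?S) (auto simp: top_unique)
  have fg: "\<bar>f x - g x\<bar> \<le> \<epsilon>" if "x \<in> topspace X" for x
  proof -
    have "ennreal \<bar>f x - g x\<bar> \<le> ennreal \<epsilon>"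
      unfolding \<epsilon>(2) [symmetric] using that by (rule SUP_upper)
    then show ?thesis using \<epsilon>(1) by (simp add: ennreal_le_iff)
  qed
  then have gf: "\<bar>g x - f x\<bar> \<le> \<epsilon>" if "x \<in> topspace X" for x
    using that by (simp add: abs_minus_commute)
  have "interleaved \<epsilon> (extended_persistent_homology p k M X f)
      (extended_persistent_homology p k M X g)"
    unfolding extended_persistent_homology_def
    by (intro interleaved_persistent_image is_diagram_bifiltration assms(4) interleaved_homology
        sub_pair_bi sub_pair_bifiltration fg gf)
  \<comment> \<open>The supremum itself is an admissible shift, so it belongs to the set whose
    infimum is the distance.\<close>
  then show ?thesis
    unfolding interleaving_distance_def \<epsilon>(2) using \<epsilon>(1) by (intro Inf_lower) blast
qed

end
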